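(* Let $A\subseteq\mathbb{N}$ be a prime-like AP-set and let $M$ be an integer matrix. Then there is a $k\in\mathbb{N}$ such that the nullspace of $M$ has infinitely many vectors with all coordinates (of each such vector) being elements of the same arithmetic progression of length $k$ in $A$ if and only if $M$ is null-diagonal.
   Context: $\mathbb{N}$ denotes the set of natural numbers. For integers $k,d\ge 1$ and $a\ge 0$, the arithmetic progression of length $k$, base $a$ and step $d$ is the set $\mathrm{AP}(k,a,d)=\{a+\lambda d \mid 0\le\lambda<k\}$ ($\lambda$ an integer); it is an arithmetic progression of length $k$ in $A$ if $\mathrm{AP}(k,a,d)\subseteq A$. The progression containing the coordinates may depend on the vector. A set $A\subseteq\mathbb{N}$ is an AP-set if for every $k\ge 1$ there exists a pair $(a,d)\in\mathbb{N}^2$ such that $\mathrm{AP}(k,a,d)\subseteq A$. A set $A\subseteq\mathbb{N}$ is prime-like if for each $\mathrm{AP}(k,a,d)\subseteq A$ with $k\ge 3$ we have $\gcd(a,d)=1$. For an integer matrix $M$ with $n$ columns, $N(M)=\{x\in\mathbb{R}^n : Mx=0\}$ denotes its nullspace. $M$ is called null-diagonal if $\dim N(M)\ge 2$ and $(1,1,\ldots,1)\in N(M)$.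
   Formalization: The length k is required to be at least 3 and the infinitely many vectors must be nonconstant; otherwise the equivalence fails, e.g. for M=(1 -1) with A the primes (constant vectors), or for M=(2 -1) with A the primes and powers of 2 (k=2). *)

theory Defs
  imports "HOL-Analysis.Analysis"
begin

definition AP :: "nat \<Rightarrow> nat \<Rightarrow> nat \<Rightarrow> nat set" where
  "AP k a d = {a + l * d | l. l < k}"

text \<open>
  The function \<open>AP\<close> is total, but a progression has step at least 1; hence every quantification
  over progressions below and in the theorem carries the guard \<open>1 \<le> d\<close>.
\<close>

definition AP_set :: "nat set \<Rightarrow> bool" where
  "AP_set A \<longleftrightarrow> (\<forall>k\<ge>1. \<exists>a d. 1 \<le> d \<and> AP k a d \<subseteq> A)"

definition prime_like :: "nat set \<Rightarrow> bool" where
  "prime_like A \<longleftrightarrow> (\<forall>k a d. 3 \<le> k \<and> 1 \<le> d \<and> AP k a d \<subseteq> A \<longrightarrow> gcd a d = 1)"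

definition nullspace :: "int ^ 'n ^ 'm \<Rightarrow> (real ^ 'n) set" where
  "nullspace M = {x. map_matrix real_of_int M *v x = 0}"

definition null_diagonal :: "int ^ 'n ^ 'm \<Rightarrow> bool" where
  "null_diagonal M \<longleftrightarrow> 2 \<le> dim (nullspace M) \<and> (\<chi> i. 1) \<in> nullspace M"

text \<open>
  The theorem asks for a progression of length \<open>k \<ge> 3\<close> and for vectors that are not constant.
  Without these two restrictions the equivalence fails, in the direction towards
  \<open>null_diagonal M\<close>.
  \<^item> Constant vectors: for \<open>M = (1, -1)\<close> and \<open>A\<close> the set of primes, every vector \<open>(p, p)\<close>
    with \<open>p\<close> in a progression of length \<open>k\<close> in \<open>A\<close> lies in the nullspace, and for each \<open>k\<close>
    there are infinitely many of them, but the nullspace has dimension 1.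
  \<^item> Length 2: let \<open>M = (2, -1)\<close> and let \<open>A\<close> consist of the primes and the powers of 2. This is a
    prime-like AP-set, because \<open>prime_like\<close> says nothing about progressions of length less than 3.
    The nullspace contains all vectors \<open>(2 ^ i, 2 ^ (i + 1))\<close>, whose coordinates form
    \<open>AP 2 (2 ^ i) (2 ^ i)\<close>, but it does not contain \<open>(1, 1)\<close>.
\<close>

end

theory Submission
  imports Defs
begin

text \<open>
  Let \<open>\<one>\<close> be the all-ones vector, and write a vector with coordinates in \<open>AP k a d\<close> as
  \<open>a \<one> + d v\<close> with \<open>v\<close> in the finite set \<open>{0..<k}\<^sup>n\<close>. If \<open>M \<one> \<noteq> 0\<close>, then
  \<open>a M \<one> = - d M v\<close> determines the ratio \<open>a / d\<close> from \<open>v\<close>, and since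
  \<open>gcd a d = 1\<close> it determines \<open>a\<close> and \<open>d\<close>, so that there are only finitely many solutions. If
  \<open>M \<one> = 0\<close>, a non-constant solution is independent of \<open>\<one>\<close>.
  Conversely, a nullspace of dimension at least 2 that contains \<open>\<one>\<close> also contains a non-constant
  vector \<open>v\<close> with natural coordinates, all of them smaller than some \<open>k\<close>; every
  progression of length \<open>k\<close> in \<open>A\<close> then yields the solution \<open>a \<one> + d v\<close>, and the sub-progressions of
  long progressions yield arbitrarily many of these.
\<close>

section \<open>Nullspaces and non-constant vectors\<close>

lemma nullspace_iff:
  "x \<in> nullspace M \<longleftrightarrow> (\<forall>r. (\<Sum>c\<in>UNIV. real_of_int (M $ r $ c) * x $ c) = 0)"
  by (simp add: nullspace_def vec_eq_iff matrix_vector_mult_def map_matrix_def)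

lemma subspace_nullspace: "subspace (nullspace M)"
  unfolding nullspace_def by (rule linear_subspace_kernel) simp

lemma ex_nonconst_nullspace:
  assumes "null_diagonal M"
  obtains y i j where "y \<in> nullspace M" "y $ i \<noteq> y $ j"
proof -
  have "\<exists>y\<in>nullspace M. \<exists>i j. y $ i \<noteq> y $ j"
  proof (rule ccontr)
    assume "\<not> ?thesis"
    then have const: "y $ i = y $ j" if "y \<in> nullspace M" for y i j
      using that by blast
    have "nullspace M \<subseteq> span {\<chi> i. 1}"
    proof
      fix y assume "y \<in> nullspace M"
      \<comment> \<open>\<open>undefined\<close> is just some index: all coordinates of
        \<open>y\<close> agree.\<close>
      then have "y = (y $ undefined) *\<^sub>R (\<chi> i. 1)"
        using const by (simp add: vec_eq_iff)
      then show "y \<in> span {\<chi> i. 1}"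
        by (metis span_base span_scale singletonI)
    qed
    then have "dim (nullspace M) \<le> card {(\<chi> i. 1) :: real ^ 'a}"
      by (intro dim_le_card) auto
    then show False
      using assms by (simp add: null_diagonal_def)
  qed
  then show ?thesis using that by blast
qed

lemma two_le_dim_nullspace:
  assumes one: "(\<chi> i. 1) \<in> nullspace M" and v: "v \<in> nullspace M" "v $ i \<noteq> v $ j"
  shows "2 \<le> dim (nullspace M)"
proof -
  let ?e = "(\<chi> i. 1) :: real ^ 'a"
  have "v \<notin> span {?e}"
    using v(2) by (auto simp: span_singleton)
  moreover have "?e \<noteq> 0"
    by (simp add: vec_eq_iff)
  ultimately have "independent {v, ?e}"
    by (simp add: independent_insert)
  moreover have "v \<noteq> ?e"
    using v(2) by auto
  ultimately show ?thesis
    using independent_card_le_dim[of "{v, ?e}" "nullspace M"] one v(1) by simp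
qed

section \<open>From real to natural coordinates\<close>

lemma rat_functional:
  fixes r :: real
  assumes "r \<noteq> 0"
  obtains f :: "real \<Rightarrow> rat" where
    "\<And>x y. f (x + y) = f x + f y" "\<And>q x. f (of_rat q * x) = q * f x" "f r \<noteq> 0"
proof -
  \<comment> \<open>The reals as a vector space over the rationals: the nonzero \<open>r\<close> is
    independent there, so a linear map may be prescribed to be 1 at \<open>r\<close>.\<close>
  interpret VP: vector_space_pair "\<lambda>q (x::real). of_rat q * x" "(*) :: rat \<Rightarrow> rat \<Rightarrow> rat"
    by unfold_locales (auto simp: algebra_simps of_rat_add of_rat_mult)
  have "VP.vs1.independent {r}"
    using assms by simp
  from VP.linear_independent_extend[OF this, of "\<lambda>_. 1"]
  obtain f where f: "Vector_Spaces.linear (\<lambda>q (x::real). of_rat q * x) (*) f" "f r = (1::rat)"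
    by auto
  show ?thesis
    using VP.linear_add[OF f(1)] VP.linear_scale[OF f(1)] f(2) by (intro that[of f]) auto
qed

lemma common_denominator:
  fixes q :: "'a::finite \<Rightarrow> rat"
  obtains D :: int and z :: "'a \<Rightarrow> int" where "D > 0" "\<And>c. of_int (z c) = of_int D * q c"
proof -
  define D where "D = (\<Prod>c\<in>UNIV. snd (quotient_of (q c)))"
  have pos: "snd (quotient_of (q c)) > 0" for c
    by (simp add: quotient_of_denom_pos')
  have "\<exists>z::int. of_int z = of_int D * q c" for c
  proof -
    have "snd (quotient_of (q c)) dvd D"
      unfolding D_def by (rule dvd_prodI) auto
    then obtain t where t: "D = snd (quotient_of (q c)) * t" by (rule dvdE)
    have "q c = of_int (fst (quotient_of (q c))) / of_int (snd (quotient_of (q c)))"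
      by (rule quotient_of_div) simp
    then have "of_int D * q c = of_int (t * fst (quotient_of (q c)))"
      using pos[of c] by (simp add: t field_simps)
    then show ?thesis by metis
  qed
  then obtain z :: "'a \<Rightarrow> int" where "\<And>c. of_int (z c) = of_int D * q c" by metis
  moreover have "D > 0"
    unfolding D_def using pos by (intro prod_pos) auto
  ultimately show ?thesis using that by blast
qed

text \<open>
  The real vector \<open>y\<close> is mapped to a rational one, coordinate by coordinate, by a
  \<open>\<rat>\<close>-linear functional on \<open>\<real>\<close> that does not vanish on \<open>y $ i - y $ j\<close>.
\<close>

lemma ex_nonconst_int_nullspace:
  fixes M :: "int ^ 'n ^ 'm"
  assumes "y \<in> nullspace M" "y $ i \<noteq> y $ j"
  obtains z :: "'n \<Rightarrow> int" where "(\<chi> c. real_of_int (z c)) \<in> nullspace M" "z i \<noteq> z j"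
proof -
  have "y $ i - y $ j \<noteq> 0"
    using assms(2) by simp
  then obtain f :: "real \<Rightarrow> rat" where add: "\<And>x y. f (x + y) = f x + f y"
    and scale: "\<And>q x. f (of_rat q * x) = q * f x" and nz: "f (y $ i - y $ j) \<noteq> 0"
    using rat_functional by blast
  have f0: "f 0 = 0"
    using add[of 0 0] by simp
  have sum: "f (sum g S) = (\<Sum>c\<in>S. f (g c))" if "finite S" for g and S :: "'n set"
    using that by induction (auto simp: add f0)
  have neq: "f (y $ i) \<noteq> f (y $ j)"
    using nz add[of "y $ i - y $ j" "y $ j"] by auto
  obtain D and z :: "'n \<Rightarrow> int" where D: "D > 0" and z: "\<And>c. of_int (z c) = of_int D * f (y $ c)"
    using common_denominator[of "\<lambda>c. f (y $ c)"] by blast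
  have scale_int: "f (real_of_int n * x) = of_int n * f x" for n x
    using scale[of "of_int n" x] by simp
  have "(\<Sum>c\<in>UNIV. M $ r $ c * z c) = 0" for r
  proof -
    \<comment> \<open>The entries of \<open>M\<close> are integers, so \<open>f\<close> passes
      through each row equation and \<open>f\<close> applied to the coordinates of \<open>y\<close>
      solves it too; multiplying by \<open>D\<close> then clears denominators.\<close>
    have "0 = f (\<Sum>c\<in>UNIV. real_of_int (M $ r $ c) * y $ c)"
      using assms(1) f0 by (simp add: nullspace_iff)
    also have "\<dots> = (\<Sum>c\<in>UNIV. of_int (M $ r $ c) * f (y $ c))"
      by (simp add: sum scale_int)
    finally have "of_int D * (\<Sum>c\<in>UNIV. of_int (M $ r $ c) * f (y $ c)) = 0" by simp
    then have "of_int (\<Sum>c\<in>UNIV. M $ r $ c * z c) = (0::rat)"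
      by (simp add: z sum_distrib_left mult.left_commute)
    then show ?thesis by (simp only: of_int_eq_0_iff)
  qed
  then have "real_of_int (\<Sum>c\<in>UNIV. M $ r $ c * z c) = 0" for r by simp
  then have "(\<chi> c. real_of_int (z c)) \<in> nullspace M"
    by (simp add: nullspace_iff)
  moreover have "z i \<noteq> z j"
  proof
    assume "z i = z j"
    then have "of_int D * f (y $ i) = of_int D * f (y $ j)"
      by (metis z)
    then show False using D neq by simp
  qed
  ultimately show ?thesis using that by blast
qed

lemma ex_nonconst_nat_nullspace:
  fixes M :: "int ^ 'n ^ 'm"
  assumes "null_diagonal M"
  obtains v :: "'n \<Rightarrow> nat" and i j where "(\<chi> c. real (v c)) \<in> nullspace M" "v i \<noteq> v j"
proof -
  obtain z :: "'n \<Rightarrow> int" and i j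
    where z: "(\<chi> c. real_of_int (z c)) \<in> nullspace M" "z i \<noteq> z j"
    using ex_nonconst_nullspace[OF assms] ex_nonconst_int_nullspace by metis
  \<comment> \<open>Subtracting the least coordinate times the all-ones vector stays in the
    nullspace, keeps differences, and makes \<open>nat\<close> lossless.\<close>
  define m where "m = Min (range z)"
  have m: "m \<le> z c" for c
    unfolding m_def by (rule Min_le) auto
  have "(\<chi> c. real_of_int (z c)) - real_of_int m *\<^sub>R (\<chi> c. 1) \<in> nullspace M"
    using z(1) assms subspace_nullspace
    by (intro subspace_diff subspace_mul) (auto simp: null_diagonal_def)
  also have "(\<chi> c. real_of_int (z c)) - real_of_int m *\<^sub>R (\<chi> c. 1) = (\<chi> c. real (nat (z c - m)))"
    using m by (simp add: vec_eq_iff)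
  finally have "(\<chi> c. real (nat (z c - m))) \<in> nullspace M" .
  moreover have "nat (z i - m) \<noteq> nat (z j - m)"
    using z(2) m[of i] m[of j] by (simp add: nat_eq_iff)
  ultimately show ?thesis by (rule that)
qed

section \<open>Infinitely many solutions from long progressions\<close>

lemma AP_shift_subset:
  assumes "j + k \<le> L"
  shows "AP k (a + j * d) d \<subseteq> AP L a d"
proof
  fix x assume "x \<in> AP k (a + j * d) d"
  then obtain l where "l < k" "x = a + (j + l) * d"
    by (auto simp: AP_def algebra_simps)
  then show "x \<in> AP L a d"
    using assms by (auto simp: AP_def intro!: exI[of _ "j + l"])
qed

abbreviation AP_vec :: "nat \<Rightarrow> nat \<Rightarrow> ('n \<Rightarrow> nat) \<Rightarrow> real ^ 'n" where
  "AP_vec a d v \<equiv> \<chi> c. real (a + v c * d)"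

lemma AP_vec_eq: "AP_vec a d v = real a *\<^sub>R (\<chi> c. 1) + real d *\<^sub>R (\<chi> c. real (v c))"
  by (simp add: vec_eq_iff)

lemma ex_AP_vec:
  assumes "\<And>i. x $ i \<in> real ` AP k a d"
  obtains v where "x = AP_vec a d v" "\<And>c. v c < k"
proof -
  have "\<exists>l<k. x $ i = real (a + l * d)" for i
    using assms[of i] by (auto simp: AP_def)
  then obtain v where "\<And>c. v c < k \<and> x $ c = real (a + v c * d)" by metis
  then show ?thesis by (intro that[of v]) (auto simp: vec_eq_iff)
qed

lemma infinite_if_null_diagonal:
  fixes M :: "int ^ 'n ^ 'm"
  assumes "AP_set A" and "null_diagonal M"
  shows "\<exists>k\<ge>3. infinite {x \<in> nullspace M. (\<exists>i j. x $ i \<noteq> x $ j) \<and>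
            (\<exists>a d. 1 \<le> d \<and> AP k a d \<subseteq> A \<and> (\<forall>i. x $ i \<in> real ` AP k a d))}"
proof -
  obtain v :: "'n \<Rightarrow> nat" and i j where v: "(\<chi> c. real (v c)) \<in> nullspace M" "v i \<noteq> v j"
    by (rule ex_nonconst_nat_nullspace[OF assms(2)])
  define k where "k = 3 + Max (range v)"
  have vk: "v c < k" for c
  proof -
    have "v c \<le> Max (range v)"
      by (rule Max_ge) auto
    then show ?thesis unfolding k_def by linarith
  qed
  let ?S = "{x \<in> nullspace M. (\<exists>i j. x $ i \<noteq> x $ j) \<and>
            (\<exists>a d. 1 \<le> d \<and> AP k a d \<subseteq> A \<and> (\<forall>i. x $ i \<in> real ` AP k a d))}"
  have sol: "AP_vec a d v \<in> ?S" if "1 \<le> d" "AP k a d \<subseteq> A" for a d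
  proof -
    have "AP_vec a d v \<in> nullspace M"
      unfolding AP_vec_eq using v(1) assms(2) subspace_nullspace
      by (intro subspace_add subspace_mul) (auto simp: null_diagonal_def)
    moreover have "AP_vec a d v $ i \<noteq> AP_vec a d v $ j"
      using v(2) that(1) by simp
    moreover have "AP_vec a d v $ c \<in> real ` AP k a d" for c
      using vk[of c] unfolding AP_def by (simp del: of_nat_add of_nat_mult) blast
    ultimately show ?thesis using that by blast
  qed
  have "infinite ?S"
  proof
    assume fin: "finite ?S"
    \<comment> \<open>A progression of length \<open>n + k\<close> has windows of length
      \<open>k\<close> starting at \<open>a + t * d\<close> for each \<open>t < n\<close>. With
      \<open>v\<close> fixed these give \<open>n\<close> distinct solutions, one more than
      \<open>?S\<close> is assumed to have.\<close>
    define n where "n = Suc (card ?S)"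
    obtain a d where d: "1 \<le> d" and AP: "AP (n + k) a d \<subseteq> A"
      using assms(1)[unfolded AP_set_def, rule_format, of "n + k"] by (auto simp: n_def)
    let ?f = "\<lambda>t. AP_vec (a + t * d) d v"
    have "?f ` {..<n} \<subseteq> ?S"
    proof (rule image_subsetI)
      fix t assume "t \<in> {..<n}"
      then have "AP k (a + t * d) d \<subseteq> A"
        using AP AP_shift_subset[of t k "n + k" a d] by auto
      then show "?f t \<in> ?S" by (rule sol[OF d])
    qed
    then have "card (?f ` {..<n}) \<le> card ?S"
      by (rule card_mono[OF fin])
    moreover have "inj_on ?f {..<n}"
    proof (rule inj_onI)
      fix s t assume "?f s = ?f t"
      then have "real (a + s * d + v i * d) = real (a + t * d + v i * d)"
        by (simp only: vec_eq_iff vec_lambda_beta)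
      then show "s = t"
        using d by (simp only: of_nat_eq_iff) simp
    qed
    ultimately show False
      by (simp add: card_image n_def)
  qed
  moreover have "3 \<le> k" by (simp add: k_def)
  ultimately show ?thesis by blast
qed

section \<open>Finiteness when the all-ones vector is not in the nullspace\<close>

lemma coprime_pair_unique:
  fixes a d a' d' :: nat and p q :: real
  assumes "p \<noteq> 0" "gcd a d = 1" "gcd a' d' = 1" "1 \<le> d" "1 \<le> d'"
    and "real a * p + real d * q = 0" "real a' * p + real d' * q = 0"
  shows "a = a' \<and> d = d'"
proof -
  \<comment> \<open>Eliminating \<open>q\<close> shows that \<open>a / d\<close> and
    \<open>a' / d'\<close> are the same fraction; both are in lowest terms.\<close>
  have "(real a * real d') * p = (real a' * real d) * p"
    using assms(6,7) by algebra
  then have "real (a * d') = real (a' * d)"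
    using assms(1) by simp
  then have "a * d' = a' * d"
    by (simp only: of_nat_eq_iff)
  then show ?thesis
    using assms(2,3) coprime_crossproduct_nat[of a d a' d']
    by (simp add: coprime_iff_gcd_eq_1)
qed

lemma one_in_nullspace_if_infinite:
  fixes M :: "int ^ 'n ^ 'm"
  assumes "prime_like A" "3 \<le> k"
    and inf: "infinite {x \<in> nullspace M.
      \<exists>a d. 1 \<le> d \<and> AP k a d \<subseteq> A \<and> (\<forall>i. x $ i \<in> real ` AP k a d)}" (is "infinite ?S")
  shows "(\<chi> i. 1) \<in> nullspace M"
proof (rule ccontr)
  assume "(\<chi> i. 1) \<notin> nullspace M"
  \<comment> \<open>One row with nonzero sum suffices: its equation alone will determine
    \<open>a / d\<close> from \<open>v\<close>.\<close>
  then obtain r where p: "(\<Sum>c\<in>UNIV. real_of_int (M $ r $ c)) \<noteq> 0"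
    by (auto simp: nullspace_iff)
  define P where "P x a d v \<longleftrightarrow> x \<in> nullspace M \<and> x = AP_vec a d v \<and> (\<forall>c. v c < k) \<and> 1 \<le> d
    \<and> gcd a d = 1" for x :: "real ^ 'n" and a d v
  have "\<exists>v a d. P x a d v" if x: "x \<in> ?S" for x
  proof -
    obtain a d where ad: "1 \<le> d" "AP k a d \<subseteq> A" "\<forall>i. x $ i \<in> real ` AP k a d"
      using x by blast
    obtain v where "x = AP_vec a d v" "\<And>c. v c < k"
      using ad(3) ex_AP_vec by blast
    moreover have "gcd a d = 1"
      using assms(1,2) ad unfolding prime_like_def by blast
    ultimately show ?thesis
      using x ad(1) unfolding P_def by (intro exI[of _ v] exI[of _ a] exI[of _ d]) simp
  qed
  then have "\<forall>x\<in>?S. \<exists>v a d. P x a d v" by (rule ballI)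
  \<comment> \<open>Only \<open>v\<close> is chosen as a function of \<open>x\<close>; injectivity
    amounts to recovering \<open>a\<close> and \<open>d\<close> from it.\<close>
  from bchoice[OF this] obtain v where v: "\<forall>x\<in>?S. \<exists>a d. P x a d (v x)" by (rule exE)
  have "inj_on v ?S"
  proof (rule inj_onI)
    fix x x' assume x: "x \<in> ?S" "x' \<in> ?S" and eq: "v x = v x'"
    obtain a d a' d' where P: "P x a d (v x)" "P x' a' d' (v x)"
      using bspec[OF v x(1)] bspec[OF v x(2)] unfolding eq by (elim exE)
    let ?p = "\<Sum>c\<in>UNIV. real_of_int (M $ r $ c)"
    let ?q = "\<Sum>c\<in>UNIV. real_of_int (M $ r $ c) * real (v x c)"
    have eqn: "real b * ?p + real e * ?q = 0" if "P y b e (v x)" for y b e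
    proof -
      have "(\<Sum>c\<in>UNIV. real_of_int (M $ r $ c) * (real b + real (v x c) * real e)) = 0"
        using that by (auto simp: P_def nullspace_iff)
      then show ?thesis
        by (simp add: algebra_simps sum.distrib sum_distrib_left)
    qed
    have "a = a' \<and> d = d'"
      using P eqn[OF P(1)] eqn[OF P(2)] p
      by (intro coprime_pair_unique[of ?p]) (auto simp: P_def)
    then show "x = x'" using P by (simp add: P_def)
  qed
  \<comment> \<open>Over \<open>UNIV\<close>, extensionality is vacuous, so this is the finite set
    of all functions into \<open>{..<k}\<close>.\<close>
  moreover have "v ` ?S \<subseteq> (\<Pi>\<^sub>E c\<in>UNIV. {..<k})"
  proof (rule image_subsetI)
    fix x assume "x \<in> ?S"
    then obtain a d where "P x a d (v x)"
      using bspec[OF v] by blast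
    then show "v x \<in> (\<Pi>\<^sub>E c\<in>UNIV. {..<k})"
      by (simp add: P_def PiE_iff)
  qed
  then have "finite (v ` ?S)"
    by (rule finite_subset) (simp add: finite_PiE)
  ultimately show False
    using inf finite_imageD by blast
qed

lemma null_diagonal_if_infinite:
  fixes M :: "int ^ 'n ^ 'm"
  assumes "prime_like A" "3 \<le> k"
    and inf: "infinite {x \<in> nullspace M. (\<exists>i j. x $ i \<noteq> x $ j) \<and>
            (\<exists>a d. 1 \<le> d \<and> AP k a d \<subseteq> A \<and> (\<forall>i. x $ i \<in> real ` AP k a d))}"
  shows "null_diagonal M"
proof -
  \<comment> \<open>Dropping non-constancy only enlarges the infinite set; it is needed just for the
    dimension, where a single solution is enough.\<close>
  have one: "(\<chi> i. 1) \<in> nullspace M"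
    by (rule one_in_nullspace_if_infinite[OF assms(1,2)])
      (rule infinite_super[OF _ inf], blast)
  obtain x i j where "x \<in> nullspace M" "x $ i \<noteq> x $ j"
    using not_finite_existsD[OF inf] by blast
  then have "2 \<le> dim (nullspace M)"
    by (rule two_le_dim_nullspace[OF one])
  with one show ?thesis by (simp add: null_diagonal_def)
qed

theorem theorem13:
  fixes A :: "nat set" and M :: "int ^ 'n ^ 'm"
  assumes "prime_like A" and "AP_set A"
  shows "(\<exists>k\<ge>3. infinite {x \<in> nullspace M. (\<exists>i j. x $ i \<noteq> x $ j) \<and>
            (\<exists>a d. 1 \<le> d \<and> AP k a d \<subseteq> A \<and> (\<forall>i. x $ i \<in> real ` AP k a d))})
         \<longleftrightarrow> null_diagonal M"
  using infinite_if_null_diagonal[OF assms(2)] null_diagonal_if_infinite[OF assms(1)] by blast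

end
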